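(* Let $q$ be a prime power, $n\ge1$ an integer, and $H(x)\in\mathbb{F}_{q^n}[x]$. Let $P_H=\{\gamma\in\mathbb{F}_{q^n} : x+\gamma\,\mathrm{Tr}(H(x)) \text{ is a permutation polynomial over } \mathbb{F}_{q^n}\}$. Assume that $\mathrm{Tr}(H(x))$ is not a constant map on $\mathbb{F}_{q^n}$. Then $|P_H|\le q^n-q^{n-1}$. Equality holds if and only if $\mathrm{Tr}(H(x))$ is an $\mathbb{F}_q$-linear function of $x\in\mathbb{F}_{q^n}$, which means that there exists an element $u\in\mathbb{F}_{q^n}$ such that $\mathrm{Tr}(H(x))=\mathrm{Tr}(ux)$ for all $x\in\mathbb{F}_{q^n}$.
   Context: $\mathrm{Tr}:\mathbb{F}_{q^n}\to\mathbb{F}_q$ is the trace map $\mathrm{Tr}(x)=x+x^q+\cdots+x^{q^{n-1}}$. A polynomial $f$ over $\mathbb{F}_{q^n}$ is a permutation polynomial if the map $x\mapsto f(x)$ is a bijection of $\mathbb{F}_{q^n}$ onto itself. $|A|$ denotes the cardinality of a set $A$.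
   Formalization: The equality criterion fails if Tr(H(0)) ≠ 0 (n=1, H=x+1 gives equality, but x+1 is not linear); proved instead: for all H, equality holds iff Tr(H(x))−Tr(H(0)) is F_q-linear, i.e. equals Tr(ux) for some u; this is the printed criterion when Tr(H(0))=0. *)

theory Defs
  imports "HOL-Computational_Algebra.Computational_Algebra" "HOL-Number_Theory.Prime_Powers"
    "HOL-Library.Cardinality"
begin

text \<open>
  The field with \<open>q ^ n\<close> elements is a type \<open>'a\<close> with \<open>CARD('a) = q ^ n\<close>. Its unique subfield
  with \<open>q\<close> elements is the set of roots of \<open>X ^ q - X\<close>.
\<close>

definition subfield_Fq :: "nat \<Rightarrow> 'a::field set" where
  "subfield_Fq q = {a. a ^ q = a}"

text \<open>
  Stated over a commutative semiring so that it applies both to field elements and to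
  polynomials, giving \<open>Tr(H(x))\<close> as a polynomial in \<open>x\<close>.
\<close>

definition Tr :: "nat \<Rightarrow> nat \<Rightarrow> 'a::comm_semiring_1 \<Rightarrow> 'a" where
  "Tr q n x = (\<Sum>i<n. x ^ (q ^ i))"

lemma poly_Tr: "poly (Tr q n H) x = Tr q n (poly H x)"
  by (simp add: Tr_def poly_sum)

definition permutation_polynomial :: "'a::field poly \<Rightarrow> bool" where
  "permutation_polynomial f \<longleftrightarrow> bij (poly f)"

definition P_set :: "nat \<Rightarrow> nat \<Rightarrow> 'a::field poly \<Rightarrow> 'a set" where
  "P_set q n H = {\<gamma>. permutation_polynomial ([:0, 1:] + smult \<gamma> (Tr q n H))}"

definition Fq_linear :: "nat \<Rightarrow> ('a::field \<Rightarrow> 'a) \<Rightarrow> bool" where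
  "Fq_linear q f \<longleftrightarrow>
     (\<forall>x y. f (x + y) = f x + f y) \<and> (\<forall>a \<in> subfield_Fq q. \<forall>x. f (a * x) = a * f x)"

text \<open>
  Adding a constant to \<open>H\<close> shifts \<open>x + \<gamma> Tr(H(x))\<close> by a constant, so it does not change
  \<open>P_set q n H\<close>, but it can destroy linearity: for \<open>H = [:1, 1:]\<close> and \<open>n = 1\<close> the set
  has \<open>q - 1\<close> elements although \<open>Tr(H(x)) = x + 1\<close> is not linear. The criterion for equality
  is therefore about \<open>Tr(H(x)) - Tr(H(0))\<close>, which is \<open>Tr(H(x))\<close> itself if \<open>Tr(H(0)) = 0\<close>.
\<close>

end

theory Submission
  imports Defs
begin

text \<open>
  Write \<open>f x = Tr(H(x))\<close>. The element \<open>\<gamma>\<close> fails to lie in \<open>P_H\<close> iff \<open>\<gamma>\<close> is an inverse slope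
  \<open>(x - y) / (f y - f x)\<close> with \<open>f x \<noteq> f y\<close>. The periods of \<open>f\<close> over \<open>F_q\<close> form a proper subspace \<open>W\<close>,
  so \<open>|W| \<le> q^{n-1}\<close>, and every element outside \<open>W\<close> is a nonzero \<open>F_q\<close>-multiple of an inverse
  slope; this leaves at least \<open>(q^n - q^{n-1}) / (q - 1) = q^{n-1}\<close> inverse slopes. In the case of
  equality \<open>W\<close> is a hyperplane and every line through \<open>0\<close> outside \<open>W\<close> contains exactly one
  inverse slope, so the restriction of \<open>f\<close> to such a line, hence \<open>f\<close> itself, is affine.
\<close>

locale finite_field_extension =
  fixes q n :: nat and field_type :: "'a::finite_field itself"
  assumes primepow_q: "primepow q" and n_pos: "n \<ge> 1" and card_UNIV: "CARD('a) = q ^ n"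
begin

abbreviation Fq :: "'a set" where "Fq \<equiv> subfield_Fq q"

section \<open>The Frobenius power and closure properties of the subfield\<close>

lemma q_gt_1: "q > 1"
  using primepow_gt_Suc_0[OF primepow_q] by simp

lemma card_UNIV_Suc: "CARD('a) = q * q ^ (n - 1)"
  using card_UNIV n_pos by (cases n) auto

text \<open>Adding \<open>1\<close> permutes the field, so summing all elements gives
  \<open>CARD('a) = 0\<close> in the field. The characteristic therefore divides a power of
  \<open>p\<close>, hence is \<open>p\<close>.\<close>

lemma power_q_add: "(x + y) ^ q = x ^ q + (y :: 'a) ^ q"
proof -
  obtain p k where pk: "prime p" "k > 0" "q = p ^ k"
    using primepow_q unfolding primepow_def by auto
  have "(\<Sum>x\<in>UNIV. x + 1 :: 'a) = (\<Sum>x\<in>UNIV. x)"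
    by (rule sum.reindex_bij_witness[where i = "\<lambda>x. x - 1" and j = "\<lambda>x. x + 1"]) auto
  hence "of_nat CARD('a) = (0 :: 'a)" by (simp add: sum.distrib)
  hence "CHAR('a) dvd CARD('a)" by (simp only: of_nat_eq_0_iff_char_dvd)
  hence "CHAR('a) dvd p ^ (k * n)"
    using card_UNIV pk(3) by (simp only: power_mult)
  hence "CHAR('a) = p"
    using pk(1) CHAR_prime[where ?'a = 'a] prime_dvd_power primes_dvd_imp_eq by blast
  thus ?thesis
    using freshmans_dream'[where ?'a = 'a and m = q and n = k] pk CHAR_prime[where ?'a = 'a] by simp
qed

lemma power_q_power_add: "(x + y) ^ (q ^ i) = x ^ (q ^ i) + (y :: 'a) ^ (q ^ i)"
  by (induction i arbitrary: x y) (simp_all add: power_mult power_q_add)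

lemma zero_in_Fq: "0 \<in> Fq" and one_in_Fq: "1 \<in> Fq"
  using q_gt_1 by (auto simp: subfield_Fq_def)

lemma Fq_add: "a \<in> Fq \<Longrightarrow> b \<in> Fq \<Longrightarrow> a + b \<in> Fq"
  by (auto simp: subfield_Fq_def power_q_add)

lemma Fq_mult: "a \<in> Fq \<Longrightarrow> b \<in> Fq \<Longrightarrow> a * b \<in> Fq"
  by (auto simp: subfield_Fq_def power_mult_distrib)

lemma Fq_divide: "a \<in> Fq \<Longrightarrow> b \<in> Fq \<Longrightarrow> a / b \<in> Fq"
  by (auto simp: subfield_Fq_def power_divide)

lemma Fq_uminus: "a \<in> Fq \<Longrightarrow> - a \<in> Fq"
  using power_q_add[of a "-a"] q_gt_1 by (auto simp: subfield_Fq_def zero_power add_eq_0_iff)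

lemma Fq_diff: "a \<in> Fq \<Longrightarrow> b \<in> Fq \<Longrightarrow> a - b \<in> Fq"
  using Fq_add[OF _ Fq_uminus] by fastforce

lemmas Fq_closed = zero_in_Fq one_in_Fq Fq_add Fq_mult Fq_divide Fq_uminus Fq_diff

section \<open>The trace and the size of the subfield\<close>

lemma Tr_add: "Tr q n (x + y :: 'a) = Tr q n x + Tr q n y"
  by (simp add: Tr_def power_q_power_add sum.distrib)

lemma Tr_scale:
  assumes "a \<in> Fq"
  shows "Tr q n (a * x :: 'a) = a * Tr q n x"
proof -
  have "a ^ (q ^ i) = a" for i
    using assms by (induction i) (auto simp: power_mult subfield_Fq_def)
  thus ?thesis by (simp add: Tr_def power_mult_distrib sum_distrib_left)
qed

lemma Tr_in_Fq: "Tr q n (x :: 'a) \<in> Fq"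
proof -
  have frob: "(\<Sum>i\<in>A. f i) ^ q = (\<Sum>i\<in>A. f i ^ q)" for A and f :: "nat \<Rightarrow> 'a"
    using q_gt_1 by (induction A rule: infinite_finite_induct) (auto simp: power_q_add)
  \<comment> \<open>The power \<open>q\<close> shifts every exponent by one. Adding \<open>x\<close>
    restores the missing index \<open>0\<close>, and the surplus last term is
    \<open>x ^ (q ^ n) = x\<close>.\<close>
  have "(\<Sum>i<n. x ^ (q ^ i)) ^ q + x = (\<Sum>i<n. x ^ (q ^ Suc i)) + x ^ (q ^ 0)"
    by (simp add: frob mult.commute flip: power_mult)
  also have "\<dots> = (\<Sum>i<Suc n. x ^ (q ^ i))"
    by (subst sum.lessThan_Suc_shift) simp
  also have "\<dots> = (\<Sum>i<n. x ^ (q ^ i)) + x"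
    using finite_field_power_card_eq_same[of x] card_UNIV by simp
  finally show ?thesis by (simp add: subfield_Fq_def Tr_def)
qed

text \<open>The fibre is the root set of a polynomial of degree at most \<open>q ^ (n - 1)\<close>.
  Its coefficient there is \<open>1\<close>, untouched by \<open>c\<close> because the exponent is
  positive.\<close>

lemma card_Tr_fibre_le: "card {x :: 'a. Tr q n x = c} \<le> q ^ (n - 1)"
proof -
  define p :: "'a poly" where "p = (\<Sum>i<n. monom 1 (q ^ i)) - [:c:]"
  have "coeff p (q ^ (n - 1)) = (\<Sum>i<n. if i = n - 1 then 1 else 0)"
    using q_gt_1 by (simp add: p_def coeff_sum coeff_pCons split: nat.split)
  hence "p \<noteq> 0" using n_pos by auto
  moreover have "degree p \<le> q ^ (n - 1)"
    unfolding p_def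
  proof (intro degree_diff_le degree_sum_le)
    fix i assume "i \<in> {..<n}"
    thus "degree (monom (1 :: 'a) (q ^ i)) \<le> q ^ (n - 1)"
      using q_gt_1 by (auto simp: degree_monom_eq intro!: power_increasing)
  qed auto
  ultimately have "card {x. poly p x = 0} \<le> q ^ (n - 1)"
    using card_poly_roots_bound order_trans by blast
  moreover have "poly p x = Tr q n x - c" for x
    by (simp add: p_def poly_sum poly_monom Tr_def)
  ultimately show ?thesis by simp
qed

text \<open>
  The lower bound: the trace maps \<open>q^n\<close> elements into \<open>F_q\<close> with fibres of size at most \<open>q^{n-1}\<close>.
\<close>

lemma card_Fq: "card Fq = q"
proof (rule antisym)
  define p :: "'a poly" where "p = monom 1 q - monom 1 1"
  have "coeff p q = 1" using q_gt_1 by (simp add: p_def)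
  hence "p \<noteq> 0" by auto
  moreover have "degree p \<le> q"
    unfolding p_def using q_gt_1 by (intro degree_diff_le) (auto simp: degree_monom_eq)
  ultimately have "card {x. poly p x = 0} \<le> q"
    using card_poly_roots_bound order_trans by blast
  thus "card Fq \<le> q" by (simp add: p_def poly_monom subfield_Fq_def)
next
  have "(UNIV :: 'a set) = (\<Union>c\<in>Fq. {x. Tr q n x = c})"
    using Tr_in_Fq by auto
  hence "CARD('a) \<le> (\<Sum>c\<in>Fq. card {x :: 'a. Tr q n x = c})"
    by (metis card_UN_le finite)
  also have "\<dots> \<le> card Fq * q ^ (n - 1)"
    using sum_mono[of Fq, OF card_Tr_fibre_le] by simp
  finally show "q \<le> card Fq" using q_gt_1 by (simp add: card_UNIV_Suc)
qed

section \<open>Linear functionals and their representation by the trace\<close>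

lemma card_fibre:
  fixes L :: "'a \<Rightarrow> 'a"
  assumes lin: "Fq_linear q L" and range: "range L \<subseteq> Fq" and z: "L z \<noteq> 0" and s: "s \<in> Fq"
  shows "card {x. L x = s} = q ^ (n - 1)"
proof -
  \<comment> \<open>Since \<open>L e = 1\<close>, translation by \<open>t * e\<close> moves one
    fibre onto another, so \<open>Fq\<close> times a single fibre parametrizes the whole
    field.\<close>
  define e where "e = z / L z"
  have add: "L (x + y) = L x + L y" and scale: "a \<in> Fq \<Longrightarrow> L (a * x) = a * L x" for a x y
    using lin by (auto simp: Fq_linear_def)
  have "L e = 1"
    using scale[of "1 / L z" z] range z by (auto simp: e_def intro: Fq_closed)
  hence shift: "L (x + t * e) = L x + t" if "t \<in> Fq" for t x
    using that by (simp add: add scale)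
  have diff: "s - L y \<in> Fq" for y
    using range s by (auto intro: Fq_closed)
  have "inj_on (\<lambda>(t, x). x + t * e) (Fq \<times> {x. L x = s})"
  proof (intro inj_onI, clarify)
    fix t x t' x'
    assume *: "t \<in> Fq" "t' \<in> Fq" "x + t * e = x' + t' * e" "s = L x" "L x' = L x"
    have "L x + t = L x' + t'" using *(1-3) by (metis shift)
    hence "t = t'" using *(5) by simp
    thus "t = t' \<and> x = x'" using *(3) by simp
  qed
  moreover have "y \<in> (\<lambda>(t, x). x + t * e) ` (Fq \<times> {x. L x = s})" for y
  proof -
    have "L (y + (s - L y) * e) = s" by (simp add: shift[OF diff])
    moreover have "- (s - L y) \<in> Fq" using diff by (rule Fq_uminus)
    moreover have "y = (y + (s - L y) * e) + (- (s - L y)) * e"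
      by (simp add: algebra_simps)
    ultimately show ?thesis
      by (intro image_eqI[of _ _ "(- (s - L y), y + (s - L y) * e)"]) auto
  qed
  ultimately have "bij_betw (\<lambda>(t, x). x + t * e) (Fq \<times> {x. L x = s}) UNIV"
    unfolding bij_betw_def by blast
  hence "q * card {x. L x = s} = CARD('a)"
    by (auto dest!: bij_betw_same_card simp: card_cartesian_product card_Fq)
  thus ?thesis using q_gt_1 by (simp add: card_UNIV_Suc)
qed

lemma Fq_linear_Tr: "Fq_linear q (\<lambda>x :: 'a. Tr q n (u * x))"
  using Tr_scale by (auto simp: Fq_linear_def Tr_add distrib_left mult.left_commute)

lemma Fq_linear_diff:
  "Fq_linear q L \<Longrightarrow> Fq_linear q M \<Longrightarrow> Fq_linear q (\<lambda>x :: 'a. L x - M x)"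
  by (simp add: Fq_linear_def algebra_simps)

lemma Fq_linear_zero: "Fq_linear q (L :: 'a \<Rightarrow> 'a) \<Longrightarrow> L 0 = 0"
  unfolding Fq_linear_def by (metis add_cancel_right_right)

lemma Tr_not_zero: "\<exists>x :: 'a. Tr q n x \<noteq> 0"
proof (rule ccontr)
  assume "\<not> ?thesis"
  hence "q * q ^ (n - 1) \<le> q ^ (n - 1)"
    using card_Tr_fibre_le[of 0] card_UNIV_Suc by simp
  thus False using q_gt_1 by simp
qed

text \<open>
  Count the pairs \<open>(u, x)\<close> with \<open>L x = Tr(ux)\<close>. If no \<open>u\<close> represented \<open>L\<close>, each \<open>u\<close> would
  contribute \<open>q^{n-1}\<close> pairs; but each \<open>x \<noteq> 0\<close> contributes \<open>q^{n-1}\<close> pairs and \<open>x = 0\<close>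
  contributes \<open>q^n\<close>.
\<close>

lemma Fq_linear_imp_Tr:
  fixes L :: "'a \<Rightarrow> 'a"
  assumes lin: "Fq_linear q L" and range: "range L \<subseteq> Fq"
  shows "\<exists>u. \<forall>x. L x = Tr q n (u * x)"
proof (rule ccontr)
  assume none: "\<not> ?thesis"
  let ?N = "q ^ (n - 1)"
  let ?S = "\<lambda>u x. if L x = Tr q n (u * x) then 1 :: nat else 0"
  have "(\<Sum>x\<in>UNIV. ?S u x) = ?N" for u
  proof -
    from none obtain z where z: "L z - Tr q n (u * z) \<noteq> 0" by auto
    have "card {x. L x - Tr q n (u * x) = 0} = ?N"
      using range by (intro card_fibre[OF Fq_linear_diff[OF lin Fq_linear_Tr] _ z])
        (auto intro: Fq_closed Tr_in_Fq)
    thus ?thesis by (simp add: sum.If_cases)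
  qed
  hence "(\<Sum>u\<in>UNIV. \<Sum>x\<in>UNIV. ?S u x) = CARD('a) * ?N" by simp
  moreover have "(\<Sum>u\<in>UNIV. \<Sum>x\<in>UNIV. ?S u x) = CARD('a) + (CARD('a) - 1) * ?N"
  proof -
    have "(\<Sum>u\<in>UNIV. ?S u x) = ?N" if "x \<noteq> 0" for x
    proof -
      \<comment> \<open>Now \<open>x\<close> is fixed and \<open>u\<close> varies: the functional
        taking \<open>u\<close> to \<open>Tr q n (x * u)\<close> is nonzero at
        \<open>w / x\<close>.\<close>
      obtain w :: 'a where w: "Tr q n w \<noteq> 0" using Tr_not_zero by blast
      have z: "Tr q n (x * (w / x)) \<noteq> 0" using w that by simp
      have "card {u. Tr q n (x * u) = L x} = ?N"
        using range by (intro card_fibre[OF Fq_linear_Tr _ z]) (auto intro: Tr_in_Fq)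
      moreover have "{u. Tr q n (x * u) = L x} = {u. L x = Tr q n (u * x)}"
        by (auto simp: mult.commute)
      ultimately show ?thesis by (simp add: sum.If_cases)
    qed
    hence "(\<Sum>x\<in>UNIV - {0}. \<Sum>u\<in>UNIV. ?S u x) = (CARD('a) - 1) * ?N"
      by (simp add: card_Diff_singleton)
    moreover have "(\<Sum>u\<in>UNIV. ?S u 0) = CARD('a)"
      using Fq_linear_zero[OF lin] Fq_linear_zero[OF Fq_linear_Tr] by simp
    ultimately show ?thesis
      by (subst sum.swap, subst sum.remove[where x = 0]) auto
  qed
  ultimately have "CARD('a) * ?N = CARD('a) + (CARD('a) - 1) * ?N" by simp
  moreover have "CARD('a) = Suc (CARD('a) - 1)" by simp
  ultimately have "?N = CARD('a)"
    by (metis add_right_cancel mult_Suc)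
  thus False using q_gt_1 card_UNIV_Suc by simp
qed

section \<open>Inverse slopes, periods and the permutation criterion\<close>

definition inverse_slopes :: "('a \<Rightarrow> 'a) \<Rightarrow> 'a set" where
  "inverse_slopes f = {(x - y) / (f y - f x) | x y. f x \<noteq> f y}"

text \<open>Letting \<open>t\<close> run over \<open>Fq\<close> makes this an
  \<open>Fq\<close>-subspace for every \<open>f\<close>; plain additive periods need only be closed
  under integer multiples.\<close>

definition periods :: "('a \<Rightarrow> 'a) \<Rightarrow> 'a set" where
  "periods f = {w. \<forall>x. \<forall>t\<in>Fq. f (x + t * w) = f x}"

lemma P_set_eq: "P_set q n H = - inverse_slopes (\<lambda>x. Tr q n (poly H x))"
proof -
  let ?f = "\<lambda>x. Tr q n (poly H x)"
  have "permutation_polynomial ([:0, 1:] + smult g (Tr q n H)) \<longleftrightarrow> inj (\<lambda>x. x + g * ?f x)" for g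
  proof -
    have "poly ([:0, 1:] + smult g (Tr q n H)) = (\<lambda>x. x + g * ?f x)"
      by (simp add: fun_eq_iff poly_Tr)
    thus ?thesis
      using finite_UNIV_inj_surj[OF finite, of "\<lambda>x. x + g * ?f x"]
      by (auto simp: permutation_polynomial_def bij_def)
  qed
  moreover have "inj (\<lambda>x. x + g * ?f x) \<longleftrightarrow> g \<notin> inverse_slopes ?f" for g
  proof -
    \<comment> \<open>Solving a collision for \<open>g\<close> gives this quotient; the swapped
      order in the denominator absorbs the sign.\<close>
    have "x + g * ?f x = y + g * ?f y \<and> x \<noteq> y \<longleftrightarrow> ?f x \<noteq> ?f y \<and> g = (x - y) / (?f y - ?f x)" for x y
    proof (cases "?f x = ?f y")
      case False
      hence "g = (x - y) / (?f y - ?f x) \<longleftrightarrow> x + g * ?f x = y + g * ?f y"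
        by (auto simp: eq_divide_eq algebra_simps)
      with False show ?thesis by auto
    qed auto
    thus ?thesis unfolding inj_def inverse_slopes_def by blast
  qed
  ultimately show ?thesis by (auto simp: P_set_def)
qed

section \<open>Lower bound for the number of inverse slopes\<close>

context
  fixes f :: "'a \<Rightarrow> 'a"
  assumes range_f: "range f \<subseteq> Fq" and nonconst: "\<not> (\<exists>c. \<forall>x. f x = c)"
begin

lemma periods_scale: "w \<in> periods f \<Longrightarrow> t \<in> Fq \<Longrightarrow> t * w \<in> periods f"
  unfolding periods_def using Fq_mult by (auto simp flip: mult.assoc)

lemma periods_diff: "v \<in> periods f \<Longrightarrow> w \<in> periods f \<Longrightarrow> v - w \<in> periods f"
proof -
  assume vw: "v \<in> periods f" "w \<in> periods f"
  have "f (x + t * (v - w)) = f x" if "t \<in> Fq" for x t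
  proof -
    have "f (x + t * (v - w)) = f ((x + t * v) + (- t) * w)" by (simp add: algebra_simps)
    also have "\<dots> = f (x + t * v)" using vw(2) Fq_uminus[OF that] unfolding periods_def by blast
    also have "\<dots> = f x" using vw(1) that by (simp add: periods_def)
    finally show ?thesis .
  qed
  thus ?thesis by (simp add: periods_def)
qed

lemma period_shift: "w \<in> periods f \<Longrightarrow> f (x + w) = f x"
  using one_in_Fq by (fastforce simp: periods_def)

lemma exists_nonperiod: "\<exists>v. v \<notin> periods f"
proof -
  obtain x where "f x \<noteq> f 0" using nonconst by blast
  hence "x \<notin> periods f" using period_shift[of x 0] by auto
  thus ?thesis ..
qed

text \<open>If two pairs with equal image had different scalars, dividing by the difference of the
  scalars would make \<open>v\<close> a period.\<close>

lemma inj_on_line_plus_periods: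
  assumes "v \<notin> periods f"
  shows "inj_on (\<lambda>(t, w). t * v + w) (Fq \<times> periods f)"
proof (intro inj_onI, clarify)
  fix t w t' w'
  assume *: "t \<in> Fq" "t' \<in> Fq" "w \<in> periods f" "w' \<in> periods f" "t * v + w = t' * v + w'"
  have "t = t'"
  proof (rule ccontr)
    assume ne: "t \<noteq> t'"
    have "(t - t') * v = w' - w" using *(5) by (simp add: algebra_simps)
    hence "v = 1 / (t - t') * (w' - w)" using ne by (simp add: field_simps)
    moreover have "1 / (t - t') \<in> Fq" using * by (intro Fq_closed)
    ultimately show False
      using assms * periods_diff periods_scale by metis
  qed
  thus "t = t' \<and> w = w'" using * by simp
qed

lemma card_periods_le: "card (periods f) \<le> q ^ (n - 1)"
proof -
  obtain v where "v \<notin> periods f" using exists_nonperiod by blast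
  from card_inj_on_le[OF inj_on_line_plus_periods[OF this], of UNIV]
  have "q * card (periods f) \<le> q * q ^ (n - 1)"
    by (simp add: card_cartesian_product card_Fq card_UNIV_Suc)
  thus ?thesis using q_gt_1 by simp
qed

text \<open>\<open>f\<close> changes along some step \<open>t * v\<close> exactly when a nonzero
  \<open>Fq\<close>-multiple of \<open>v\<close> is an inverse slope; the scalars lie in
  \<open>Fq\<close> because the values of \<open>f\<close> do.\<close>

lemma scaled_inverse_slopes:
  "(\<lambda>(s, d). s * d) ` ((Fq - {0}) \<times> inverse_slopes f) = - periods f"
proof (intro equalityI subsetI)
  fix v assume "v \<in> - periods f"
  then obtain x t where xt: "t \<in> Fq" "f (x + t * v) \<noteq> f x" by (auto simp: periods_def)
  let ?d = "(x - (x + t * v)) / (f (x + t * v) - f x)"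
  let ?s = "(f x - f (x + t * v)) / t"
  have "t \<noteq> 0" using xt by auto
  hence "v = ?s * ?d" using xt(2) by (simp add: field_simps)
  moreover have "?d \<in> inverse_slopes f"
    unfolding inverse_slopes_def using xt(2)
    by (intro CollectI exI[of _ x] exI[of _ "x + t * v"]) simp
  moreover have "?s \<in> Fq" using range_f xt(1) by (intro Fq_closed) auto
  moreover have "?s \<noteq> 0" using xt(2) \<open>t \<noteq> 0\<close> by auto
  ultimately show "v \<in> (\<lambda>(s, d). s * d) ` ((Fq - {0}) \<times> inverse_slopes f)"
    by (intro image_eqI[of _ _ "(?s, ?d)"]) auto
next
  fix v assume "v \<in> (\<lambda>(s, d). s * d) ` ((Fq - {0}) \<times> inverse_slopes f)"
  then obtain s d where "s \<in> Fq" "s \<noteq> 0" "v = s * d" "d \<in> inverse_slopes f"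
    by auto
  then obtain x y where s: "s \<in> Fq" "s \<noteq> 0" "v = s * ((x - y) / (f y - f x))" "f x \<noteq> f y"
    unfolding inverse_slopes_def by blast
  have "(f y - f x) / s * v = x - y" using s by simp
  hence "y + (f y - f x) / s * v = x" by simp
  moreover have "(f y - f x) / s \<in> Fq" using s range_f by (intro Fq_closed) auto
  ultimately show "v \<in> - periods f"
    using s(4) unfolding periods_def by (metis (mono_tags, lifting) ComplI mem_Collect_eq)
qed

text \<open>Chained together these give the lower bound. With exactly \<open>q ^ (n - 1)\<close>
  inverse slopes both ends of the chain agree, so every inequality is an equality.\<close>

lemma card_inverse_slopes_bounds:
  "q ^ n - q ^ (n - 1) \<le> card (- periods f)"
  "card (- periods f) \<le> (q - 1) * card (inverse_slopes f)"
  "(q - 1) * q ^ (n - 1) = q ^ n - q ^ (n - 1)"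
proof -
  show "q ^ n - q ^ (n - 1) \<le> card (- periods f)"
    using card_periods_le card_UNIV by (simp add: Compl_eq_Diff_UNIV card_Diff_subset diff_le_mono2)
  show "card (- periods f) \<le> (q - 1) * card (inverse_slopes f)"
    using card_image_le[of "(Fq - {0}) \<times> inverse_slopes f" "\<lambda>(s, d). s * d"]
    by (simp add: scaled_inverse_slopes card_cartesian_product card_Fq zero_in_Fq)
  show "(q - 1) * q ^ (n - 1) = q ^ n - q ^ (n - 1)"
    using card_UNIV card_UNIV_Suc by (simp add: diff_mult_distrib)
qed

lemma card_inverse_slopes_ge: "q ^ (n - 1) \<le> card (inverse_slopes f)"
proof -
  have "(q - 1) * q ^ (n - 1) \<le> (q - 1) * card (inverse_slopes f)"
    using card_inverse_slopes_bounds by linarith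
  thus ?thesis using q_gt_1 by simp
qed

section \<open>The case of equality\<close>

lemma minimal_imp_inj:
  assumes "card (inverse_slopes f) = q ^ (n - 1)"
  shows "inj_on (\<lambda>(s, d). s * d) ((Fq - {0}) \<times> inverse_slopes f)"
proof (rule eq_card_imp_inj_on)
  have "card (- periods f) = (q - 1) * card (inverse_slopes f)"
    using card_inverse_slopes_bounds assms by simp
  thus "card ((\<lambda>(s, d). s * d) ` ((Fq - {0}) \<times> inverse_slopes f)) =
      card ((Fq - {0}) \<times> inverse_slopes f)"
    by (simp add: scaled_inverse_slopes card_cartesian_product card_Fq zero_in_Fq)
qed simp

text \<open>Equality in the chain gives \<open>q ^ (n - 1)\<close> periods, so the injection from
  \<open>Fq \<times> periods f\<close> is onto by counting.\<close>

lemma minimal_imp_spanned: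
  assumes "card (inverse_slopes f) = q ^ (n - 1)" and "v \<notin> periods f"
  shows "\<exists>t\<in>Fq. \<exists>w\<in>periods f. x = t * v + w"
proof -
  have "card (- periods f) = q ^ n - q ^ (n - 1)"
    using card_inverse_slopes_bounds assms by simp
  moreover have "q ^ (n - 1) \<le> CARD('a)" using q_gt_1 by (simp add: card_UNIV_Suc)
  ultimately have "card (periods f) = q ^ (n - 1)"
    using card_periods_le card_UNIV card_mono[of UNIV "periods f"]
    by (simp add: Compl_eq_Diff_UNIV card_Diff_subset)
  hence "card ((\<lambda>(t, w). t * v + w) ` (Fq \<times> periods f)) = CARD('a)"
    by (simp add: card_image[OF inj_on_line_plus_periods[OF assms(2)]] card_cartesian_product
        card_Fq card_UNIV_Suc)
  hence "(\<lambda>(t, w). t * v + w) ` (Fq \<times> periods f) = UNIV"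
    by (intro card_subset_eq) auto
  hence "x \<in> (\<lambda>(t, w). t * v + w) ` (Fq \<times> periods f)" by simp
  thus ?thesis by auto
qed

text \<open>Every element is a multiple of \<open>v\<close> plus a period, so \<open>f\<close> is
  determined by its restriction \<open>g\<close> to the line of \<open>v\<close>. Injectivity of the
  scaling map leaves only one slope for \<open>g\<close>.\<close>

lemma minimal_imp_linear:
  assumes min: "card (inverse_slopes f) = q ^ (n - 1)"
  shows "Fq_linear q (\<lambda>x. f x - f 0)"
proof -
  obtain v where v: "v \<notin> periods f" using exists_nonperiod by blast
  define g where "g t = f (t * v)" for t
  have g_Fq: "g t \<in> Fq" for t using range_f by (auto simp: g_def)
  have f_eq: "f (t * v + w) = g t" if "w \<in> periods f" for t w
    using period_shift[OF that] by (simp add: g_def)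
  obtain x where "f x \<noteq> f 0" using nonconst by blast
  then obtain b where b: "b \<in> Fq" "g b \<noteq> g 0"
    using minimal_imp_spanned[OF min v, of x] f_eq by (auto simp: g_def)
  have v0: "v \<noteq> 0" using b by (auto simp: g_def)
  have b0: "b \<noteq> 0" using b by auto
  \<comment> \<open>The slope of \<open>g\<close> between \<open>0\<close> and \<open>b\<close>,
    which equals \<open>- 1 / e\<close> for the \<open>e\<close> introduced below.\<close>
  define r where "r = (g b - g 0) / b"
  have slope: "g s - g t = r * (s - t)" if st: "s \<in> Fq" "t \<in> Fq" "g s \<noteq> g t" for s t
  proof -
    define c where "c = (s - t) / (g t - g s)"
    define e where "e = (b - 0) / (g 0 - g b)"
    have in_slopes: "(s - t) / (g t - g s) * v \<in> inverse_slopes f" if "g s \<noteq> g t" for s t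
    proof -
      have "(s - t) / (g t - g s) * v = (s * v - t * v) / (f (t * v) - f (s * v))"
        by (simp add: g_def algebra_simps diff_divide_distrib)
      thus ?thesis using that unfolding inverse_slopes_def g_def by blast
    qed
    have ce: "c \<in> Fq" "e \<in> Fq" "c \<noteq> 0" "e \<noteq> 0"
      using st b b0 g_Fq unfolding c_def e_def by (auto intro!: Fq_closed)
    have "(case (e, c * v) of (s, d) \<Rightarrow> s * d) = (case (c, e * v) of (s, d) \<Rightarrow> s * d)"
      by simp
    hence "(e, c * v) = (c, e * v)"
      using in_slopes[OF st(3)] in_slopes[OF b(2)] ce
      by (intro inj_onD[OF minimal_imp_inj[OF min]]) (auto simp: c_def e_def)
    hence "c = e" by simp
    thus ?thesis using st b b0 unfolding c_def e_def r_def by (simp add: field_simps)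
  qed
  have g_eq: "g t = g 0 + r * t" if t: "t \<in> Fq" for t
  proof (cases "g t = g 0")
    case True
    \<comment> \<open>The slopes from \<open>b\<close> to \<open>t\<close> and to \<open>0\<close> are both \<open>r\<close>, with the same rise.\<close>
    have "g b - g t = r * (b - t)" "g b - g 0 = r * (b - 0)"
      using slope[of b t] slope[of b 0] b t True zero_in_Fq by auto
    hence "r * t = 0" using True by (simp add: algebra_simps)
    with True show ?thesis by simp
  next
    case False
    thus ?thesis using slope[of t 0] t zero_in_Fq by (simp add: algebra_simps)
  qed
  have f_line: "f (t * v + w) - f 0 = r * t" if "t \<in> Fq" "w \<in> periods f" for t w
    using f_eq[OF that(2)] g_eq[OF that(1)] by (simp add: g_def)
  show ?thesis
    unfolding Fq_linear_def
  proof (intro conjI allI ballI)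
    fix x y
    obtain s w t w' where d: "s \<in> Fq" "w \<in> periods f" "x = s * v + w"
        "t \<in> Fq" "w' \<in> periods f" "y = t * v + w'"
      using minimal_imp_spanned[OF min v] by metis
    \<comment> \<open>The sum \<open>w + w'\<close> is obtained as
      \<open>w - (0 - w')\<close>.\<close>
    have "0 \<in> periods f" by (simp add: periods_def)
    hence "w + w' \<in> periods f"
      using periods_diff[OF d(2) periods_diff[OF _ d(5)], of 0] by simp
    hence "f ((s + t) * v + (w + w')) - f 0 = r * (s + t)"
      using d by (intro f_line Fq_closed)
    moreover have "x + y = (s + t) * v + (w + w')" using d by (simp add: algebra_simps)
    ultimately show "f (x + y) - f 0 = f x - f 0 + (f y - f 0)"
      using f_line d by (simp add: algebra_simps)
  next
    fix a x assume a: "a \<in> Fq"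
    obtain s w where d: "s \<in> Fq" "w \<in> periods f" "x = s * v + w"
      using minimal_imp_spanned[OF min v] by metis
    have "f ((a * s) * v + a * w) - f 0 = r * (a * s)"
      using d a by (intro f_line Fq_closed periods_scale)
    moreover have "a * x = (a * s) * v + a * w" using d by (simp add: algebra_simps)
    ultimately show "f (a * x) - f 0 = a * (f x - f 0)"
      using f_line d by simp
  qed
qed

text \<open>Scaling by \<open>1 / (f y - f x)\<close>, an element of \<open>Fq\<close>, shows that
  inverse slopes solve \<open>L z = - 1\<close>; conversely a solution \<open>z\<close> comes from
  the pair \<open>z\<close>, \<open>0\<close>. They thus form a fibre of a nonzero
  functional.\<close>

lemma linear_imp_minimal:
  assumes lin: "Fq_linear q (\<lambda>x. f x - f 0)"
  shows "card (inverse_slopes f) = q ^ (n - 1)"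
proof -
  define L where "L x = f x - f 0" for x
  have add: "L (x + y) = L x + L y" and scale: "a \<in> Fq \<Longrightarrow> L (a * x) = a * L x" for a x y
    using lin by (auto simp: Fq_linear_def L_def)
  have L_Fq: "L x \<in> Fq" for x using range_f by (auto simp: L_def intro: Fq_closed)
  have diff: "f x - f y = L (x - y)" for x y
    using add[of "x - y" y] by (simp add: L_def diff_eq_eq add_ac)
  have "inverse_slopes f = {z. L z = - 1}"
  proof (intro equalityI subsetI)
    fix d assume "d \<in> inverse_slopes f"
    then obtain x y where d: "d = (x - y) / (f y - f x)" "f x \<noteq> f y"
      by (auto simp: inverse_slopes_def)
    have "L (1 / (f y - f x) * (x - y)) = 1 / (f y - f x) * L (x - y)"
      using range_f by (intro scale Fq_closed) auto
    also have "\<dots> = - 1" using d by (simp add: divide_eq_eq flip: diff)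
    finally show "d \<in> {z. L z = - 1}" using d by simp
  next
    fix z assume "z \<in> {z. L z = - 1}"
    hence "f z - f 0 = - 1" by (simp add: L_def)
    hence "f 0 - f z = 1" by (metis minus_diff_eq minus_minus)
    hence "z = (z - 0) / (f 0 - f z)" "f z \<noteq> f 0" by auto
    thus "z \<in> inverse_slopes f" unfolding inverse_slopes_def by blast
  qed
  moreover obtain z where "f z \<noteq> f 0" using nonconst by blast
  ultimately show ?thesis
    using card_fibre[of L z "- 1"] lin L_Fq by (auto simp: L_def[abs_def] intro: Fq_closed)
qed

end

end

theorem theorem2p8:
  fixes q n :: nat and H :: "'a::finite_field poly"
  assumes "primepow q" and "n \<ge> 1" and "CARD('a) = q ^ n"
    and "\<not> (\<exists>c. \<forall>x. Tr q n (poly H x) = c)"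
  shows "card (P_set q n H) \<le> q ^ n - q ^ (n - 1) \<and>
    (Tr q n (poly H 0) = 0 \<longrightarrow>
      (card (P_set q n H) = q ^ n - q ^ (n - 1) \<longleftrightarrow> Fq_linear q (\<lambda>x. Tr q n (poly H x)))) \<and>
    (Fq_linear q (\<lambda>x. Tr q n (poly H x)) \<longleftrightarrow>
      (\<exists>u. \<forall>x. Tr q n (poly H x) = Tr q n (u * x))) \<and>
    (card (P_set q n H) = q ^ n - q ^ (n - 1) \<longleftrightarrow>
      Fq_linear q (\<lambda>x. Tr q n (poly H x) - Tr q n (poly H 0))) \<and>
    (Fq_linear q (\<lambda>x. Tr q n (poly H x) - Tr q n (poly H 0)) \<longleftrightarrow>
      (\<exists>u. \<forall>x. Tr q n (poly H x) - Tr q n (poly H 0) = Tr q n (u * x)))"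
proof -
  interpret finite_field_extension q n "TYPE('a)"
    using assms(1-3) by unfold_locales
  define f where "f x = Tr q n (poly H x)" for x
  have f_Fq: "f x \<in> Fq" for x unfolding f_def by (rule Tr_in_Fq)
  have nonconst: "\<not> (\<exists>c. \<forall>x. f x = c)" using assms(4) by (simp add: f_def)
  have range_f: "range f \<subseteq> Fq" and range_diff: "range (\<lambda>x. f x - f 0) \<subseteq> Fq"
    using f_Fq by (auto intro: Fq_diff)
  have "card (P_set q n H) = q ^ n - card (inverse_slopes f)"
    using card_UNIV by (simp add: P_set_eq Compl_eq_Diff_UNIV card_Diff_subset f_def[abs_def])
  moreover have "q ^ (n - 1) \<le> card (inverse_slopes f)"
    using card_inverse_slopes_ge[OF range_f nonconst] .
  \<comment> \<open>With this bound the truncated subtraction from \<open>q ^ n\<close> loses no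
    information, so equal differences mean equal subtrahends.\<close>
  moreover have "card (inverse_slopes f) \<le> q ^ n"
    using card_mono[of UNIV "inverse_slopes f"] card_UNIV by simp
  moreover have "card (inverse_slopes f) = q ^ (n - 1) \<longleftrightarrow> Fq_linear q (\<lambda>x. f x - f 0)"
    using minimal_imp_linear[OF range_f nonconst] linear_imp_minimal[OF range_f nonconst] by blast
  ultimately have le: "card (P_set q n H) \<le> q ^ n - q ^ (n - 1)"
    and eq: "card (P_set q n H) = q ^ n - q ^ (n - 1) \<longleftrightarrow> Fq_linear q (\<lambda>x. f x - f 0)"
    by auto
  \<comment> \<open>Applied below both to \<open>f\<close> and to \<open>f\<close> minus its value
    at \<open>0\<close>.\<close>
  have Tr_iff: "Fq_linear q L \<longleftrightarrow> (\<exists>u. \<forall>x. L x = Tr q n (u * x))"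
    if "range L \<subseteq> Fq" for L :: "'a \<Rightarrow> 'a"
  proof
    assume "\<exists>u. \<forall>x. L x = Tr q n (u * x)"
    then obtain u where "L = (\<lambda>x. Tr q n (u * x))" by auto
    thus "Fq_linear q L" using Fq_linear_Tr by simp
  qed (use Fq_linear_imp_Tr that in blast)
  show ?thesis
    using le eq Tr_iff[OF range_f] Tr_iff[OF range_diff] unfolding f_def by simp
qed

end
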